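(* Let $d\ge 1$, $\phi:\{-1,1\}^d\to\{-1,1\}$ and $E_d=\{-1,1\}^d$. There exists an integer $k\in\{0,\dots,d\}$ such that $2^k$ is the maximal number of pairwise non-accordable elements of $E_d$, and such that for every $a\in E_d$, $2^{d-k}$ is the maximal number of elements of $E_d$ simultaneously accordable with $a$ (i.e. the maximal cardinality of a subset of $E_d$ containing $a$ whose elements are simultaneously accordable).
   Context: For $\alpha\in\{-1,1\}$, $f_\alpha:E_d\to E_d$ is defined by $f_\alpha(x_1,\dots,x_d)=(x_2,\dots,x_d,\alpha\,\phi(x_1,\dots,x_d))$. Elements $a,b\in E_d$ are accordable if there is a finite sequence of signs $\alpha_1,\dots,\alpha_l\in\{-1,1\}$ such that $f_{\alpha_l}\circ\cdots\circ f_{\alpha_1}$ takes the same value at $a$ and $b$. Elements $a_1,\dots,a_m$ are simultaneously accordable if there is a finite sequence of signs $\alpha_1,\dots,\alpha_l$ such that $f_{\alpha_l}\circ\cdots\circ f_{\alpha_1}$ takes the same value at $a_1,\dots,a_m$. *)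

theory Defs
  imports "HOL-Library.FuncSet"
begin

abbreviation signs :: "int set" where
  "signs \<equiv> {-1, 1}"

text \<open>The tuple \<open>(x\<^sub>1, \<dots>, x\<^sub>d)\<close> is encoded as the list \<open>[x\<^sub>1, \<dots>, x\<^sub>d]\<close>.\<close>

definition E :: "nat \<Rightarrow> int list set" where
  "E d = {x. set x \<subseteq> signs \<and> length x = d}"

definition step :: "(int list \<Rightarrow> int) \<Rightarrow> int \<Rightarrow> int list \<Rightarrow> int list" where
  "step \<phi> \<alpha> x = tl x @ [\<alpha> * \<phi> x]"

text \<open>
  \<open>fold\<close> applies the head of the list first, so \<open>fold (step \<phi>) [\<alpha>\<^sub>1, \<dots>, \<alpha>\<^sub>l]\<close> is
  \<open>step \<phi> \<alpha>\<^sub>l \<circ> \<dots> \<circ> step \<phi> \<alpha>\<^sub>1\<close>.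
\<close>

definition accordable :: "(int list \<Rightarrow> int) \<Rightarrow> int list \<Rightarrow> int list \<Rightarrow> bool" where
  "accordable \<phi> a b \<longleftrightarrow>
     (\<exists>\<alpha>s \<in> lists signs. fold (step \<phi>) \<alpha>s a = fold (step \<phi>) \<alpha>s b)"

definition simultaneously_accordable :: "(int list \<Rightarrow> int) \<Rightarrow> int list set \<Rightarrow> bool" where
  "simultaneously_accordable \<phi> S \<longleftrightarrow>
     (\<exists>\<alpha>s \<in> lists signs. \<forall>a\<in>S. \<forall>b\<in>S. fold (step \<phi>) \<alpha>s a = fold (step \<phi>) \<alpha>s b)"

text \<open>Hence the sets of cardinalities of subsets of \<open>E d\<close> are finite and \<open>Max\<close> is meaningful on them.\<close>

lemma finite_E: "finite (E d)"
  unfolding E_def by (rule finite_lists_length_eq) simp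

end

theory Submission
  imports Defs "HOL-Computational_Algebra.Primes"
begin

text \<open>
  The maps \<open>step \<phi> \<alpha>\<close> label the edges of the de Bruijn graph on \<open>E d\<close>. The key fact
  about this labelling is that, for every start \<open>x\<close>, the sign words of length \<open>d\<close> lead from \<open>x\<close>
  to each element of \<open>E d\<close> exactly once (\<open>run_bij_betw\<close>); these words are themselves the elements
  of \<open>E d\<close>. Counting the pairs \<open>(w, x)\<close> with \<open>x \<in> T\<close> for which the word \<open>w\<close> leads from \<open>x\<close> into
  \<open>S\<close> therefore gives
  \<open>(\<Sum>w\<in>E d. card {x \<in> T. run w x \<in> S}) = card T * card S\<close> (\<open>sum_card_hits\<close>).

  Preimages of simultaneously accordable sets are simultaneously accordable, so they meet a set of
  pairwise non-accordable elements at most once. Hence \<open>card T * card S \<le> 2 ^ d\<close> whenever \<open>T\<close> is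
  pairwise non-accordable and \<open>S\<close> is simultaneously accordable. Conversely, the image \<open>T\<close> of a word
  of minimal rank is pairwise non-accordable, because otherwise prolonging the word would lower its
  rank, and the fibres of the word are \<open>card T\<close> simultaneously accordable sets covering \<open>E d\<close>.
  So both maxima are attained in an equality \<open>card T * card S = 2 ^ d\<close>, and both are powers of two.

  Finally, if \<open>S\<close> has the maximal cardinality, the identity for \<open>T = E d\<close> says that the preimages
  of \<open>S\<close> have average size \<open>card S\<close>. None is larger, so all of them are maximal. Every \<open>a\<close> lies in
  such a preimage, which is why the second maximum does not depend on \<open>a\<close>.
  This is Friedman's argument for the synchronizing sets of a road colouring.
\<close>

section \<open>Simultaneously accordable sets\<close>

lemma card_E: "card (E d) = 2 ^ d"
  unfolding E_def by (simp add: card_lists_length_eq numeral_2_eq_2)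

lemma E_subset_lists: "E d \<subseteq> lists signs"
  unfolding E_def by auto

lemma simultaneously_accordable_imp_accordable:
  assumes "simultaneously_accordable \<phi> S" "a \<in> S" "b \<in> S"
  shows "accordable \<phi> a b"
  using assms unfolding simultaneously_accordable_def accordable_def by blast

lemma simultaneously_accordable_singleton: "simultaneously_accordable \<phi> {a}"
  unfolding simultaneously_accordable_def by (rule bexI[of _ "[]"]) auto

lemma simultaneously_accordable_fibre:
  assumes "w \<in> lists signs"
  shows "simultaneously_accordable \<phi> {x \<in> A. fold (step \<phi>) w x = y}"
  unfolding simultaneously_accordable_def by (rule bexI[OF _ assms]) auto

lemma simultaneously_accordable_preimage:
  assumes "simultaneously_accordable \<phi> S" "w \<in> lists signs"
  shows "simultaneously_accordable \<phi> {x \<in> A. fold (step \<phi>) w x \<in> S}"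
proof -
  from assms(1) obtain u where u: "u \<in> lists signs"
    "\<forall>a\<in>S. \<forall>b\<in>S. fold (step \<phi>) u a = fold (step \<phi>) u b"
    unfolding simultaneously_accordable_def by blast
  show ?thesis
    unfolding simultaneously_accordable_def
  proof (rule bexI)
    show "w @ u \<in> lists signs" using u(1) assms(2) by simp
  qed (use u(2) in simp)
qed

section \<open>Words of length \<open>d\<close> as paths in the de Bruijn graph\<close>

context
  fixes d :: nat and \<phi> :: "int list \<Rightarrow> int"
  assumes d_pos: "d \<ge> 1" and \<phi>: "\<phi> \<in> E d \<rightarrow> signs"
begin

abbreviation run :: "int list \<Rightarrow> int list \<Rightarrow> int list" where
  "run \<equiv> fold (step \<phi>)"

lemma step_in_E: "\<alpha> \<in> signs \<Longrightarrow> x \<in> E d \<Longrightarrow> step \<phi> \<alpha> x \<in> E d"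
proof -
  assume \<alpha>: "\<alpha> \<in> signs" and x: "x \<in> E d"
  have "\<phi> x \<in> signs" using \<phi> x by blast
  then have "\<alpha> * \<phi> x \<in> signs" using \<alpha> by auto
  then show "step \<phi> \<alpha> x \<in> E d"
    using x d_pos unfolding E_def step_def by (cases x) auto
qed

lemma run_in_E: "w \<in> lists signs \<Longrightarrow> x \<in> E d \<Longrightarrow> run w x \<in> E d"
proof (induction w arbitrary: x)
  case (Cons \<alpha> w)
  then have "step \<phi> \<alpha> x \<in> E d" by (intro step_in_E) simp_all
  then show ?case using Cons by simp
qed simp

text \<open>
  Each step shifts the state and appends a sign; since \<open>\<phi>\<close> takes the values \<open>\<plusminus>1\<close>, both signs can
  be produced, so any word can be written into the last places.
\<close>

lemma run_reaches:
  assumes "x \<in> E d" "set y \<subseteq> signs" "length y \<le> d"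
  shows "\<exists>w\<in>lists signs. length w = length y \<and> run w x = drop (length y) x @ y"
  using assms(2,3)
proof (induction y rule: rev_induct)
  case Nil
  show ?case by (rule bexI[of _ "[]"]) auto
next
  case (snoc z y)
  then obtain w where w: "w \<in> lists signs" "length w = length y"
    "run w x = drop (length y) x @ y" by auto
  let ?q = "run w x"
  have "?q \<in> E d" using w(1) assms(1) by (rule run_in_E)
  then have q: "\<phi> ?q \<in> signs" using \<phi> by blast
  have z: "z \<in> signs" using snoc.prems by simp
  have "length y < length x" using snoc.prems assms(1) by (simp add: E_def)
  then have "tl ?q = drop (Suc (length y)) x @ y"
    unfolding w(3) by (simp add: drop_Suc drop_tl tl_append2)
  \<comment> \<open>The sign that appends \<open>z\<close> to the state \<open>?q\<close>.\<close>
  moreover have "z * \<phi> ?q * \<phi> ?q = z" using q by auto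
  ultimately have "run (w @ [z * \<phi> ?q]) x = drop (length (y @ [z])) x @ y @ [z]"
    by (simp add: step_def)
  moreover have "w @ [z * \<phi> ?q] \<in> lists signs" using w(1) q z by auto
  ultimately show ?case using w(2) by (intro bexI[of _ "w @ [z * \<phi> ?q]"]) auto
qed

text \<open>
  Words of length \<open>d\<close> overwrite the whole state, so every target is reached; and there are as many
  such words as targets, so none is reached twice.
\<close>

lemma run_bij_betw:
  assumes "x \<in> E d"
  shows "bij_betw (\<lambda>w. run w x) (E d) (E d)"
proof -
  have "(\<lambda>w. run w x) ` E d = E d"
  proof
    show "(\<lambda>w. run w x) ` E d \<subseteq> E d"
      using run_in_E[OF _ assms] E_subset_lists by blast
    show "E d \<subseteq> (\<lambda>w. run w x) ` E d"
    proof
      fix y assume "y \<in> E d"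
      then obtain w where "w \<in> lists signs" "length w = d" "run w x = y"
        using run_reaches[OF assms, of y] assms by (auto simp: E_def)
      then show "y \<in> (\<lambda>w. run w x) ` E d"
        by (intro image_eqI[of _ _ w]) (auto simp: E_def)
    qed
  qed
  then show ?thesis
    unfolding bij_betw_def using eq_card_imp_inj_on[OF finite_E] by metis
qed

text \<open>Double counting: by \<open>run_bij_betw\<close>, each \<open>x \<in> T\<close> is led into \<open>S\<close> by \<open>card S\<close> words.\<close>

lemma sum_card_hits:
  assumes "T \<subseteq> E d" "S \<subseteq> E d"
  shows "(\<Sum>w\<in>E d. card {x \<in> T. run w x \<in> S}) = card T * card S"
proof -
  have "card {w \<in> E d. run w x \<in> S} = card S" if "x \<in> T" for x
  proof -
    have bij: "bij_betw (\<lambda>w. run w x) (E d) (E d)"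
      using that assms(1) by (intro run_bij_betw) auto
    have "inj_on (\<lambda>w. run w x) {w \<in> E d. run w x \<in> S}"
      by (rule inj_on_subset[OF bij_betw_imp_inj_on[OF bij]]) auto
    moreover have "(\<lambda>w. run w x) ` {w \<in> E d. run w x \<in> S} = (\<lambda>w. run w x) ` E d \<inter> S"
      by auto
    moreover have "\<dots> = S" using bij_betw_imp_surj_on[OF bij] assms(2) by auto
    ultimately have "bij_betw (\<lambda>w. run w x) {w \<in> E d. run w x \<in> S} S"
      by (simp add: bij_betw_def)
    then show ?thesis by (rule bij_betw_same_card)
  qed
  then have "(\<Sum>w\<in>E d. card {x \<in> T. run w x \<in> S}) = (\<Sum>x\<in>T. card S)"
    using assms(1) by (intro sum_multicount_gen) (auto intro: finite_subset finite_E)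
  then show ?thesis by simp
qed

section \<open>Non-accordable sets against simultaneously accordable sets\<close>

text \<open>
  For each word the preimage of \<open>S\<close> is simultaneously accordable, so it contains at most one element
  of \<open>T\<close>; there are \<open>2 ^ d\<close> words in the double counting.
\<close>

lemma card_non_accordable_mult_card_accordable_le:
  assumes "T \<subseteq> E d" "pairwise (\<lambda>a b. \<not> accordable \<phi> a b) T"
    and "S \<subseteq> E d" "simultaneously_accordable \<phi> S"
  shows "card T * card S \<le> 2 ^ d"
proof -
  have "card {x \<in> T. run w x \<in> S} \<le> 1" if "w \<in> E d" for w
  proof -
    have "w \<in> lists signs" using that E_subset_lists by blast
    then have "accordable \<phi> x y" if "x \<in> {x \<in> T. run w x \<in> S}" "y \<in> {x \<in> T. run w x \<in> S}" for x y
      using that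
      by (rule simultaneously_accordable_imp_accordable
          [OF simultaneously_accordable_preimage[OF assms(4)]])
    then have "x = y" if "x \<in> {x \<in> T. run w x \<in> S}" "y \<in> {x \<in> T. run w x \<in> S}" for x y
      using that assms(2) unfolding pairwise_def by blast
    then show ?thesis by (simp add: card_le_Suc0_iff_eq finite_subset[OF assms(1) finite_E])
  qed
  then have "(\<Sum>w\<in>E d. card {x \<in> T. run w x \<in> S}) \<le> (\<Sum>w\<in>E d. 1)" by (rule sum_mono)
  then show ?thesis by (simp add: sum_card_hits[OF assms(1,3)] card_E)
qed

text \<open>
  Some word has an image of least cardinality. That image is the required set: an accordable pair
  of distinct elements could be merged by a further word.
\<close>

lemma ex_non_accordable_image:
  "\<exists>w\<in>lists signs. pairwise (\<lambda>a b. \<not> accordable \<phi> a b) (run w ` E d)"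
proof -
  have "\<exists>w. w \<in> lists signs \<and> (\<forall>u. u \<in> lists signs \<longrightarrow>
      card (run w ` E d) \<le> card (run u ` E d))"
    by (rule ex_has_least_nat[of _ "[]"]) simp
  then obtain w where w: "w \<in> lists signs"
    and least: "\<And>u. u \<in> lists signs \<Longrightarrow> card (run w ` E d) \<le> card (run u ` E d)"
    by blast
  have "\<not> accordable \<phi> p q"
    if pq: "p \<in> run w ` E d" "q \<in> run w ` E d" "p \<noteq> q" for p q
  proof
    assume "accordable \<phi> p q"
    then obtain u where u: "u \<in> lists signs" "run u p = run u q"
      unfolding accordable_def by blast
    have fin: "finite (run w ` E d)" by (simp add: finite_E)
    have "\<not> inj_on (run u) (run w ` E d)" using pq u(2) by (meson inj_onD)
    then have "card (run u ` run w ` E d) < card (run w ` E d)"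
      using fin card_image_le[OF fin, of "run u"] eq_card_imp_inj_on[OF fin, of "run u"] by linarith
    moreover have "run u ` run w ` E d = run (w @ u) ` E d"
      by (auto simp: image_image)
    moreover have "w @ u \<in> lists signs" using u(1) w by simp
    ultimately show False using least[of "w @ u"] by simp
  qed
  then show ?thesis using w unfolding pairwise_def by blast
qed

text \<open>
  The reverse inequality: the fibres of a word whose image \<open>T\<close> is pairwise non-accordable split
  \<open>E d\<close> into \<open>card T\<close> simultaneously accordable sets, each of size at most \<open>M\<close>.
\<close>

lemma ex_non_accordable_covering:
  assumes "\<And>S. S \<subseteq> E d \<Longrightarrow> simultaneously_accordable \<phi> S \<Longrightarrow> card S \<le> M"
  shows "\<exists>T\<subseteq>E d. pairwise (\<lambda>a b. \<not> accordable \<phi> a b) T \<and> 2 ^ d \<le> card T * M"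
proof -
  obtain w where w: "w \<in> lists signs" "pairwise (\<lambda>a b. \<not> accordable \<phi> a b) (run w ` E d)"
    using ex_non_accordable_image by blast
  have "(2::nat) ^ d = (\<Sum>x\<in>E d. 1)" by (simp add: card_E)
  also have "\<dots> = (\<Sum>y\<in>run w ` E d. \<Sum>x | x \<in> E d \<and> run w x = y. 1)"
    by (rule sum.image_gen[OF finite_E])
  also have "\<dots> = (\<Sum>y\<in>run w ` E d. card {x \<in> E d. run w x = y})" by simp
  also have "\<dots> \<le> (\<Sum>y\<in>run w ` E d. M)"
    by (intro sum_mono assms simultaneously_accordable_fibre w(1)) auto
  finally have "2 ^ d \<le> card (run w ` E d) * M" by simp
  moreover have "run w ` E d \<subseteq> E d" using run_in_E[OF w(1)] by auto
  ultimately show ?thesis using w(2) by blast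
qed

section \<open>The largest simultaneously accordable sets\<close>

text \<open>
  The preimages of a largest set under the words of length \<open>d\<close> are at most as large, and have the
  same size on average; so all are largest. One of the words leads \<open>a\<close> into the given set.
\<close>

lemma ex_largest_accordable_containing:
  assumes max: "\<And>S'. S' \<subseteq> E d \<Longrightarrow> simultaneously_accordable \<phi> S' \<Longrightarrow> card S' \<le> card S"
    and S: "S \<subseteq> E d" "simultaneously_accordable \<phi> S" "S \<noteq> {}"
    and a: "a \<in> E d"
  shows "\<exists>S'\<subseteq>E d. a \<in> S' \<and> simultaneously_accordable \<phi> S' \<and> card S' = card S"
proof -
  define pre where "pre w = {x \<in> E d. run w x \<in> S}" for w
  have pre_acc: "simultaneously_accordable \<phi> (pre w)" if "w \<in> E d" for w
    unfolding pre_def using that E_subset_lists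
    by (intro simultaneously_accordable_preimage S(2)) blast
  have pre_le: "card (pre w) \<le> card S" if "w \<in> E d" for w
    using that by (intro max pre_acc) (auto simp: pre_def)
  obtain p where p: "p \<in> S" using S(3) by blast
  then have "p \<in> (\<lambda>w. run w a) ` E d"
    using run_bij_betw[OF a] S(1) unfolding bij_betw_def by blast
  then obtain w where w: "w \<in> E d" "run w a = p" by blast
  have "(\<Sum>w\<in>E d. card (pre w)) = (\<Sum>w\<in>E d. card S)"
    unfolding pre_def using sum_card_hits[OF order_refl S(1)] by simp
  then have "card (pre w) = card S"
    by (rule sum_mono_inv) (use pre_le w(1) finite_E in auto)
  moreover have "a \<in> pre w" "pre w \<subseteq> E d" using a p w(2) by (auto simp: pre_def)
  ultimately show ?thesis using pre_acc[OF w(1)] by blast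
qed

end

section \<open>The two maxima\<close>

theorem theorem23:
  fixes d :: nat and \<phi> :: "int list \<Rightarrow> int"
  assumes "d \<ge> 1" and "\<phi> \<in> E d \<rightarrow> signs"
  shows "\<exists>k\<in>{0..d}.
    Max {card S | S. S \<subseteq> E d \<and> pairwise (\<lambda>a b. \<not> accordable \<phi> a b) S} = 2 ^ k \<and>
    (\<forall>a\<in>E d. Max {card S | S. S \<subseteq> E d \<and> a \<in> S \<and> simultaneously_accordable \<phi> S} = 2 ^ (d - k))"
proof -
  have fin: "finite {card S | S. S \<subseteq> E d \<and> P S}" for P
    by (rule finite_subset[of _ "card ` Pow (E d)"]) (auto simp: finite_E)
  define SA where "SA S \<longleftrightarrow> S \<subseteq> E d \<and> simultaneously_accordable \<phi> S" for S
  have "replicate d 1 \<in> E d" by (auto simp: E_def)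
  then have one: "SA {replicate d 1}"
    by (simp add: SA_def simultaneously_accordable_singleton)
  have "card S < Suc (card (E d))" if "SA S" for S
    using that by (simp add: SA_def card_mono finite_E less_Suc_eq_le)
  then have "\<exists>S. SA S \<and> (\<forall>S'. SA S' \<longrightarrow> card S' \<le> card S)"
    by (intro ex_has_greatest_nat[of SA, OF one]) blast
  then obtain S where S: "SA S" and max: "\<And>S'. SA S' \<Longrightarrow> card S' \<le> card S"
    by blast
  have "card S \<ge> 1" using max[OF one] by simp
  then have "S \<noteq> {}" by auto
  obtain T where T: "T \<subseteq> E d" "pairwise (\<lambda>a b. \<not> accordable \<phi> a b) T"
    "2 ^ d \<le> card T * card S"
    using ex_non_accordable_covering[OF assms, of "card S"] max by (auto simp: SA_def)
  have le: "card T' * card S \<le> 2 ^ d"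
    if "T' \<subseteq> E d" "pairwise (\<lambda>a b. \<not> accordable \<phi> a b) T'" for T'
    using card_non_accordable_mult_card_accordable_le[OF assms that] S by (simp add: SA_def)
  have eq: "card T * card S = 2 ^ d" using T(3) le[OF T(1,2)] by simp
  then have "card T dvd 2 ^ d" by (metis dvd_triv_left)
  then obtain k where k: "k \<le> d" "card T = 2 ^ k"
    using divides_primepow_nat[OF two_is_prime_nat] by blast
  have "2 ^ k * card S = 2 ^ k * 2 ^ (d - k)"
    using eq k by (simp flip: power_add)
  then have cardS: "card S = 2 ^ (d - k)" by simp
  have "card T' \<le> card T"
    if "T' \<subseteq> E d" "pairwise (\<lambda>a b. \<not> accordable \<phi> a b) T'" for T'
    using le[OF that] \<open>card S \<ge> 1\<close> unfolding eq[symmetric] by simp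
  then have "Max {card S | S. S \<subseteq> E d \<and> pairwise (\<lambda>a b. \<not> accordable \<phi> a b) S} = card T"
    using T(1,2) by (intro Max_eqI fin) auto
  moreover have "Max {card S | S. S \<subseteq> E d \<and> a \<in> S \<and> simultaneously_accordable \<phi> S} = card S"
    if a: "a \<in> E d" for a
  proof -
    obtain S' where "S' \<subseteq> E d" "a \<in> S'" "simultaneously_accordable \<phi> S'" "card S' = card S"
      using ex_largest_accordable_containing
          [OF assms max[unfolded SA_def, OF conjI] _ _ \<open>S \<noteq> {}\<close> a] S
      unfolding SA_def by blast
    then have "card S \<in> {card S | S. S \<subseteq> E d \<and> a \<in> S \<and> simultaneously_accordable \<phi> S}"
      by (metis (mono_tags, lifting) mem_Collect_eq)
    then show ?thesis using max by (intro Max_eqI fin) (auto simp: SA_def)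
  qed
  ultimately show ?thesis using k cardS by (intro bexI[of _ k]) auto
qed

end
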